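(* For every $n\ge1$, the number $\mathrm{ILF}_n^2$ of forests $F=(F_1,\ldots,F_n)$ of $n$ binary shrubs with label set $\{1,\ldots,3n\}$ satisfying $F_1<_L F_2<_L\cdots<_L F_n$ equals $$\mathrm{ILF}_n^2=\frac{4^n\,(3n)!}{(n+1)!\,(2n+1)!}.$$
   Context: A binary shrub is a root with an ordered pair of children (left, right), labeled by distinct positive integers with the root's label smaller than both children's labels; its word is (root label, left child label, right child label). A forest of $n$ binary shrubs with label set $\{1,\ldots,3n\}$ is an ordered sequence of $n$ binary shrubs whose labels together are exactly $\{1,\ldots,3n\}$, each used once. For shrubs with words $abc$ and $def$, $abc<_L def$ means $a<d$, $b<e$ and $c<f$. *)

theory Defs
  imports Complex_Main
begin

datatype shrub = Shrub (root_label: nat) (left_label: nat) (right_label: nat)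

definition word :: "shrub \<Rightarrow> nat list" where
  "word S = [root_label S, left_label S, right_label S]"

definition binary_shrub :: "shrub \<Rightarrow> bool" where
  "binary_shrub S \<longleftrightarrow> (\<forall>x \<in> set (word S). 0 < x) \<and> distinct (word S) \<and>
     root_label S < left_label S \<and> root_label S < right_label S"

definition less_L :: "shrub \<Rightarrow> shrub \<Rightarrow> bool"  (infix \<open><\<^sub>L\<close> 50) where
  "S <\<^sub>L T \<longleftrightarrow> root_label S < root_label T \<and> left_label S < left_label T \<and>
     right_label S < right_label T"

definition shrub_forests :: "nat \<Rightarrow> shrub list set" where
  "shrub_forests n = {F. length F = n \<and> (\<forall>S \<in> set F. binary_shrub S) \<and>
     distinct (concat (map word F)) \<and> set (concat (map word F)) = {1..3 * n}}"

definition ILF2 :: "nat \<Rightarrow> nat" where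
  "ILF2 n = card {F \<in> shrub_forests n. successively (<\<^sub>L) F}"

end

theory Submission
  imports Defs "HOL-Computational_Algebra.Formal_Power_Series" "HOL-Computational_Algebra.Polynomial"
begin

unbundle fps_syntax

text \<open>
  Reading the labels \<open>1, 2, \<dots>, 3n\<close> in order, and recording whether each is a root, a left child
  or a right child, turns an increasing forest into a Kreweras walk: a walk in the quarter plane
  from the origin to itself with steps $(1,1)$, $(-1,0)$, $(0,-1)$.

  Let $R(x)$ be the generating function, in the length variable $t$, of the walks ending on the
  $x$-axis. If $ab = t(a + b + a^2b^2)$, then the step-by-step recurrence telescopes to
  $ab = t a R(a) + t b R(b)$, and these two equations force $I(a) = I(b)$ for
  $I(x) = t^2x^2R(x)^2 - xR(x) + 2tR(x) + x$. As one solution $b = b(a, t)$ is $O(t)$, this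
  invariance makes $I$ independent of $x$, whence
  \[ t^2x^2R(x)^2 - xR(x) + 2tR(x) + x = 2tR(0). \]
  Differentiating in $x$ and substituting the series $x = W(t)$ that annihilates the coefficient of
  $R'(x)$ gives $W = t(2 + W^3)$ and $8tR(0) = 4W - W^4$. Consequently $R(0)$ satisfies a linear
  differential equation, which is a two-term recurrence for its coefficients.
\<close>

subsection \<open>Forests and Kreweras walks\<close>

text \<open>The state after the labels up to \<open>N\<close> have been read: \<open>as\<close>,
  \<open>bs\<close>, \<open>cs\<close> hold the roots, left and right children so far. The walk
  stands at \<open>(i, j)\<close>, the excess of roots over left and over right children. The last
  two conditions pair the k-th child with the k-th root.\<close>

definition partial_fillings :: "nat \<Rightarrow> nat \<Rightarrow> nat \<Rightarrow> (nat list \<times> nat list \<times> nat list) set" where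
  "partial_fillings N i j = {(as, bs, cs).
     sorted_wrt (<) as \<and> sorted_wrt (<) bs \<and> sorted_wrt (<) cs \<and>
     distinct (as @ bs @ cs) \<and> set (as @ bs @ cs) = {1..N} \<and>
     length as = length bs + i \<and> length as = length cs + j \<and>
     (\<forall>k<length bs. as ! k < bs ! k) \<and> (\<forall>k<length cs. as ! k < cs ! k)}"

text \<open>\<open>kreweras N i j\<close> counts the quarter plane walks of length \<open>N\<close> from the origin to \<open>(i, j)\<close>; the
  recurrence is on the last step.\<close>

fun kreweras :: "nat \<Rightarrow> nat \<Rightarrow> nat \<Rightarrow> nat" where
  "kreweras 0 i j = (if i = 0 \<and> j = 0 then 1 else 0)"
| "kreweras (Suc N) i j =
     (if 0 < i \<and> 0 < j then kreweras N (i - 1) (j - 1) else 0)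
     + kreweras N (Suc i) j + kreweras N i (Suc j)"

lemma sorted_wrt_less_max_last:
  fixes xs :: "nat list"
  assumes "sorted_wrt (<) xs" "x \<in> set xs" "\<forall>y\<in>set xs. y \<le> x"
  obtains ys where "xs = ys @ [x]"
proof -
  obtain ys zs where xs: "xs = ys @ x # zs"
    using assms(2) by (auto simp: in_set_conv_decomp)
  have "zs = []"
    using assms(1,3) unfolding xs by (cases zs) (auto simp: sorted_wrt_append)
  with xs that show thesis by blast
qed

lemma partial_fillings_0:
  "partial_fillings 0 i j = (if i = 0 \<and> j = 0 then {([], [], [])} else {})"
  by (auto simp: partial_fillings_def)

text \<open>The largest label ends one of the three sorted lists, and deleting it undoes the last
  step: a root came from \<open>(i - 1, j - 1)\<close>, a left child from \<open>(Suc i, j)\<close>,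
  a right child from \<open>(i, Suc j)\<close>.\<close>

lemma partial_fillings_Suc:
  "partial_fillings (Suc N) i j =
     (\<lambda>(as, bs, cs). (as @ [Suc N], bs, cs)) `
       (if 0 < i \<and> 0 < j then partial_fillings N (i - 1) (j - 1) else {})
     \<union> (\<lambda>(as, bs, cs). (as, bs @ [Suc N], cs)) ` partial_fillings N (Suc i) j
     \<union> (\<lambda>(as, bs, cs). (as, bs, cs @ [Suc N])) ` partial_fillings N i (Suc j)"
  (is "?L = ?A \<union> ?B \<union> ?C")
proof (intro equalityI subsetI)
  fix z assume z: "z \<in> ?L"
  obtain as bs cs where [simp]: "z = (as, bs, cs)" by (cases z)
  have S: "sorted_wrt (<) as" "sorted_wrt (<) bs" "sorted_wrt (<) cs"
    and D: "distinct (as @ bs @ cs)" and U: "set (as @ bs @ cs) = {1..Suc N}"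
    and L: "length as = length bs + i" "length as = length cs + j"
    and Lb: "\<forall>k<length bs. as ! k < bs ! k" and Lc: "\<forall>k<length cs. as ! k < cs ! k"
    using z by (auto simp: partial_fillings_def)
  have ub: "y \<le> Suc N" if "y \<in> set as \<union> set bs \<union> set cs" for y
  proof -
    have "y \<in> set (as @ bs @ cs)" using that by simp
    then show ?thesis unfolding U by simp
  qed
  have rm: "{1..N} = {1..Suc N} - {Suc N}" by auto
  have "Suc N \<in> set (as @ bs @ cs)" unfolding U by simp
  then consider "Suc N \<in> set as" | "Suc N \<in> set bs" | "Suc N \<in> set cs" by auto
  then show "z \<in> ?A \<union> ?B \<union> ?C"
  proof cases
    case 1
    then obtain as' where as: "as = as' @ [Suc N]"
      using sorted_wrt_less_max_last[OF S(1) 1] ub by blast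
    \<comment> \<open>If \<open>bs\<close> were longer than \<open>as'\<close>, one of its entries
      would have to exceed the root \<open>Suc N\<close>, the maximum. Hence the excess
      \<open>i\<close> was positive, and \<open>ck\<close> gives the same for
      \<open>j\<close>.\<close>
    have bk: "k < length as'" if "k < length bs" for k
    proof (rule ccontr)
      assume "\<not> k < length as'"
      then have "length as' < length bs" using that by simp
      then have "as ! length as' < bs ! length as'" "bs ! length as' \<in> set bs"
        using Lb by auto
      then show False using ub[of "bs ! length as'"] by (simp add: as)
    qed
    have ck: "k < length as'" if "k < length cs" for k
    proof (rule ccontr)
      assume "\<not> k < length as'"
      then have "length as' < length cs" using that by simp
      then have "as ! length as' < cs ! length as'" "cs ! length as' \<in> set cs"
        using Lc by auto
      then show False using ub[of "cs ! length as'"] by (simp add: as)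
    qed
    have i: "0 < i" using bk[of "length as'"] L(1) by (cases i) (auto simp: as)
    have j: "0 < j" using ck[of "length as'"] L(2) by (cases j) (auto simp: as)
    have "set (as' @ bs @ cs) = {1..N}"
      unfolding rm U[symmetric] using D by (auto simp: as)
    moreover have "as' ! k < bs ! k" if "k < length bs" for k
      using Lb[rule_format, of k] bk[OF that] that by (simp add: as nth_append)
    moreover have "as' ! k < cs ! k" if "k < length cs" for k
      using Lc[rule_format, of k] ck[OF that] that by (simp add: as nth_append)
    ultimately have "(as', bs, cs) \<in> partial_fillings N (i - 1) (j - 1)"
      using S D L i j unfolding partial_fillings_def by (simp add: as sorted_wrt_append)
    then have "z \<in> ?A" using i j
      by (intro image_eqI[of _ _ "(as', bs, cs)"]) (simp_all add: as)
    then show ?thesis by blast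
  next
    case 2
    then obtain bs' where bs: "bs = bs' @ [Suc N]"
      using sorted_wrt_less_max_last[OF S(2) 2] ub by blast
    have "set (as @ bs' @ cs) = {1..N}"
      unfolding rm U[symmetric] using D by (auto simp: bs)
    moreover have "as ! k < bs' ! k" if "k < length bs'" for k
      using Lb[rule_format, of k] that by (simp add: bs nth_append)
    ultimately have "(as, bs', cs) \<in> partial_fillings N (Suc i) j"
      using S D L Lc unfolding partial_fillings_def by (simp add: bs sorted_wrt_append)
    then have "z \<in> ?B"
      by (intro image_eqI[of _ _ "(as, bs', cs)"]) (simp_all add: bs)
    then show ?thesis by blast
  next
    case 3
    then obtain cs' where cs: "cs = cs' @ [Suc N]"
      using sorted_wrt_less_max_last[OF S(3) 3] ub by blast
    have "set (as @ bs @ cs') = {1..N}"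
      unfolding rm U[symmetric] using D by (auto simp: cs)
    moreover have "as ! k < cs' ! k" if "k < length cs'" for k
      using Lc[rule_format, of k] that by (simp add: cs nth_append)
    ultimately have "(as, bs, cs') \<in> partial_fillings N i (Suc j)"
      using S D L Lb unfolding partial_fillings_def by (simp add: cs sorted_wrt_append)
    then have "z \<in> ?C"
      by (intro image_eqI[of _ _ "(as, bs, cs')"]) (simp_all add: cs)
    then show ?thesis by blast
  qed
next
  have lt: "x < Suc N" if "x \<in> set xs" "set xs \<subseteq> {1..N}" for x xs
    using that by auto
  have st: "set as \<subseteq> {1..N} \<and> set bs \<subseteq> {1..N} \<and> set cs \<subseteq> {1..N}"
    if "(as, bs, cs) \<in> partial_fillings N i' j'" for as bs cs i' j'
    using that unfolding partial_fillings_def by auto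
  have un: "{1..Suc N} = insert (Suc N) {1..N}" by auto
  fix z assume "z \<in> ?A \<union> ?B \<union> ?C"
  then consider "z \<in> ?A" | "z \<in> ?B" | "z \<in> ?C" by blast
  then show "z \<in> ?L"
  proof cases
    case 1
    then obtain as bs cs where z: "z = (as @ [Suc N], bs, cs)" and ij: "0 < i" "0 < j"
      and p: "(as, bs, cs) \<in> partial_fillings N (i - 1) (j - 1)"
      by (auto split: if_splits)
    have "sorted_wrt (<) (as @ [Suc N])"
      using p st[OF p] lt[of _ as] by (simp add: partial_fillings_def sorted_wrt_append)
    moreover have "Suc N \<notin> set as" "Suc N \<notin> set bs" "Suc N \<notin> set cs"
      using st[OF p] by auto
    moreover have len: "length as + 1 = length bs + i" "length as + 1 = length cs + j"
      using p ij by (auto simp: partial_fillings_def)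
    moreover have "\<forall>k<length bs. (as @ [Suc N]) ! k < bs ! k"
      "\<forall>k<length cs. (as @ [Suc N]) ! k < cs ! k"
      using p ij len by (auto simp: partial_fillings_def nth_append)
    ultimately show ?thesis using p unfolding z partial_fillings_def un
      by simp
  next
    case 2
    then obtain as bs cs where z: "z = (as, bs @ [Suc N], cs)"
      and p: "(as, bs, cs) \<in> partial_fillings N (Suc i) j"
      by auto
    \<comment> \<open>The root paired with the new child exists, because the excess before the step
      is \<open>Suc i\<close>.\<close>
    have "as ! length bs < Suc N"
      using st[OF p] p by (intro lt[of _ as]) (auto simp: partial_fillings_def)
    then have "\<forall>k<length (bs @ [Suc N]). as ! k < (bs @ [Suc N]) ! k"
      using p by (simp add: partial_fillings_def nth_append less_Suc_eq)
    moreover have "sorted_wrt (<) (bs @ [Suc N])"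
      using p st[OF p] lt[of _ bs] by (simp add: partial_fillings_def sorted_wrt_append)
    moreover have "Suc N \<notin> set as" "Suc N \<notin> set bs" "Suc N \<notin> set cs"
      using st[OF p] by auto
    ultimately show ?thesis using p unfolding z partial_fillings_def un
      by (simp add: insert_commute)
  next
    case 3
    then obtain as bs cs where z: "z = (as, bs, cs @ [Suc N])"
      and p: "(as, bs, cs) \<in> partial_fillings N i (Suc j)"
      by auto
    have "as ! length cs < Suc N"
      using st[OF p] p by (intro lt[of _ as]) (auto simp: partial_fillings_def)
    then have "\<forall>k<length (cs @ [Suc N]). as ! k < (cs @ [Suc N]) ! k"
      using p by (simp add: partial_fillings_def nth_append less_Suc_eq)
    moreover have "sorted_wrt (<) (cs @ [Suc N])"
      using p st[OF p] lt[of _ cs] by (simp add: partial_fillings_def sorted_wrt_append)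
    moreover have "Suc N \<notin> set as" "Suc N \<notin> set bs" "Suc N \<notin> set cs"
      using st[OF p] by auto
    ultimately show ?thesis using p unfolding z partial_fillings_def un
      by (simp add: insert_commute)
  qed
qed

text \<open>The three images in the step are disjoint, since they differ in which list contains
  \<open>Suc N\<close>. Finiteness is carried through the same induction because the cardinality of
  the union needs it.\<close>

lemma card_partial_fillings:
  "finite (partial_fillings N i j) \<and> card (partial_fillings N i j) = kreweras N i j"
proof (induction N arbitrary: i j)
  case 0
  then show ?case by (simp add: partial_fillings_0)
next
  case (Suc N)
  define P where "P = (if 0 < i \<and> 0 < j then partial_fillings N (i - 1) (j - 1) else {})"
  define A where "A = (\<lambda>(as, bs, cs). (as @ [Suc N], bs, cs)) ` P"
  define B where "B = (\<lambda>(as, bs, cs). (as, bs @ [Suc N], cs)) ` partial_fillings N (Suc i) j"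
  define C where "C = (\<lambda>(as, bs, cs). (as, bs, cs @ [Suc N])) ` partial_fillings N i (Suc j)"
  have eq: "partial_fillings (Suc N) i j = A \<union> B \<union> C"
    unfolding A_def B_def C_def P_def by (rule partial_fillings_Suc)
  have fin: "finite A" "finite B" "finite C"
    using Suc.IH by (auto simp: A_def B_def C_def P_def)
  have cA: "card A = (if 0 < i \<and> 0 < j then kreweras N (i - 1) (j - 1) else 0)"
    unfolding A_def by (subst card_image) (auto simp: inj_on_def P_def Suc.IH)
  have cB: "card B = kreweras N (Suc i) j"
    unfolding B_def by (subst card_image) (auto simp: inj_on_def Suc.IH)
  have cC: "card C = kreweras N i (Suc j)"
    unfolding C_def by (subst card_image) (auto simp: inj_on_def Suc.IH)
  have nin: "Suc N \<notin> set as \<and> Suc N \<notin> set bs \<and> Suc N \<notin> set cs"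
    if "(as, bs, cs) \<in> partial_fillings N i' j'" for as bs cs i' j'
  proof -
    have "set (as @ bs @ cs) = {1..N}" using that by (auto simp: partial_fillings_def)
    then have "Suc N \<notin> set (as @ bs @ cs)" by auto
    then show ?thesis by simp
  qed
  have A': "Suc N \<in> set (fst z) \<and> Suc N \<notin> set (fst (snd z)) \<and> Suc N \<notin> set (snd (snd z))" if "z \<in> A" for z
    using that nin by (auto simp: A_def P_def split: if_splits)
  have B': "Suc N \<notin> set (fst z) \<and> Suc N \<in> set (fst (snd z)) \<and> Suc N \<notin> set (snd (snd z))" if "z \<in> B" for z
    using that nin by (auto simp: B_def)
  have C': "Suc N \<notin> set (fst z) \<and> Suc N \<notin> set (fst (snd z)) \<and> Suc N \<in> set (snd (snd z))" if "z \<in> C" for z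
    using that nin by (auto simp: C_def)
  have "A \<inter> B = {}" "(A \<union> B) \<inter> C = {}"
    using A' B' C' by blast+
  then show ?case using fin cA cB cC unfolding eq by (simp add: card_Un_disjoint)
qed

section \<open>Increasing forests as complete fillings\<close>

lemma successively_less_L_iff:
  "successively (<\<^sub>L) F \<longleftrightarrow> sorted_wrt (<) (map root_label F) \<and>
     sorted_wrt (<) (map left_label F) \<and> sorted_wrt (<) (map right_label F)"
proof -
  have "transp (<\<^sub>L)" by (auto simp: transp_def less_L_def)
  then have "successively (<\<^sub>L) F \<longleftrightarrow> sorted_wrt (<\<^sub>L) F"
    by (simp add: successively_conv_sorted_wrt)
  also have "\<dots> \<longleftrightarrow> sorted_wrt (<) (map root_label F) \<and>
     sorted_wrt (<) (map left_label F) \<and> sorted_wrt (<) (map right_label F)"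
    by (induction F) (auto simp: less_L_def)
  finally show ?thesis .
qed

text \<open>Passing to multisets transfers both the label set and distinctness from the
  shrub-by-shrub order to the grouping by roots, left and right children.\<close>

lemma mset_concat_word:
  "mset (concat (map word F)) =
     mset (map root_label F @ map left_label F @ map right_label F)"
  by (induction F) (auto simp: word_def)

lemma concat_word:
  "set (concat (map word F)) = set (map root_label F @ map left_label F @ map right_label F)"
  "distinct (concat (map word F)) \<longleftrightarrow>
     distinct (map root_label F @ map left_label F @ map right_label F)"
  using mset_concat_word[of F] by (metis mset_eq_setD, metis mset_eq_imp_distinct_iff)

text \<open>With both excesses zero the three lists have equal length, so \<open>h\<close> can zip
  them into shrubs, inverting \<open>g\<close>.\<close>

lemma ILF2_eq_kreweras: "ILF2 n = kreweras (3 * n) 0 0"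
proof -
  define g where "g = (\<lambda>F. (map root_label F, map left_label F, map right_label F))"
  define h where "h = (\<lambda>(as, bs, cs). map (\<lambda>k. Shrub (as ! k) (bs ! k) (cs ! k)) [0..<length as])"
  have "bij_betw g {F \<in> shrub_forests n. successively (<\<^sub>L) F} (partial_fillings (3 * n) 0 0)"
  proof (rule bij_betw_byWitness[where f' = h])
    show "\<forall>F\<in>{F \<in> shrub_forests n. successively (<\<^sub>L) F}. h (g F) = F"
      by (auto simp: g_def h_def intro!: nth_equalityI)
    show "\<forall>z\<in>partial_fillings (3 * n) 0 0. g (h z) = z"
      by (auto simp: g_def h_def partial_fillings_def intro!: nth_equalityI)
    show "g ` {F \<in> shrub_forests n. successively (<\<^sub>L) F} \<subseteq> partial_fillings (3 * n) 0 0"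
    proof
      fix z assume "z \<in> g ` {F \<in> shrub_forests n. successively (<\<^sub>L) F}"
      then obtain F where z: "z = g F" and F: "F \<in> shrub_forests n" "successively (<\<^sub>L) F"
        by auto
      show "z \<in> partial_fillings (3 * n) 0 0"
        using F unfolding z shrub_forests_def g_def partial_fillings_def concat_word
          successively_less_L_iff by (simp add: binary_shrub_def)
    qed
    show "h ` partial_fillings (3 * n) 0 0 \<subseteq> {F \<in> shrub_forests n. successively (<\<^sub>L) F}"
    proof
      fix F assume "F \<in> h ` partial_fillings (3 * n) 0 0"
      then obtain as bs cs where F: "F = h (as, bs, cs)"
        and p: "(as, bs, cs) \<in> partial_fillings (3 * n) 0 0" by auto
      have len: "length bs = length as" "length cs = length as"
        using p by (auto simp: partial_fillings_def)
      have m: "map root_label F = as" "map left_label F = bs" "map right_label F = cs"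
        using len by (auto simp: F h_def intro!: nth_equalityI)
      have D: "distinct (as @ bs @ cs)" and U: "set (as @ bs @ cs) = {1..3 * n}"
        using p unfolding partial_fillings_def by auto
      have "length (as @ bs @ cs) = 3 * n"
        using distinct_card[OF D] U by simp
      then have lF: "length F = n" using len by (simp add: F h_def)
      have "binary_shrub S" if S: "S \<in> set F" for S
      proof -
        obtain k where k: "k < length as" "S = Shrub (as ! k) (bs ! k) (cs ! k)"
          using S by (auto simp: F h_def)
        have in_set: "as ! k \<in> set as" "bs ! k \<in> set bs" "cs ! k \<in> set cs"
          using k len by auto
        have "as ! k < bs ! k" "as ! k < cs ! k"
          using p k len by (auto simp: partial_fillings_def)
        moreover have "bs ! k \<noteq> cs ! k" using D in_set by auto
        moreover have "as ! k \<in> {1..3 * n}" using in_set(1) unfolding U[symmetric] by simp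
        ultimately show ?thesis by (simp add: k binary_shrub_def word_def)
      qed
      then show "F \<in> {F \<in> shrub_forests n. successively (<\<^sub>L) F}"
        using p lF unfolding shrub_forests_def concat_word successively_less_L_iff
          partial_fillings_def by (simp add: m del: set_map distinct_map set_append distinct_append)
    qed
  qed
  then show ?thesis
    using card_partial_fillings[of "3 * n" 0 0] by (simp add: ILF2_def bij_betw_same_card)
qed

subsection \<open>The step recurrence\<close>

lemma kreweras_commute: "kreweras N i j = kreweras N j i"
  by (induction N arbitrary: i j) auto

text \<open>A step raises each coordinate by at most one. This bound lets all sums over endpoints be
  truncated.\<close>

lemma kreweras_eq_0: "N < i \<or> N < j \<Longrightarrow> kreweras N i j = 0"
proof (induction N arbitrary: i j)
  case (Suc N)
  then have "N < i - 1 \<or> N < j - 1" "N < Suc i \<or> N < j" "N < i \<or> N < Suc j" by auto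
  then show ?case using Suc.IH by simp
qed auto

lemma sum_atMost_shift_up:
  fixes g :: "nat \<Rightarrow> 'a :: ab_group_add"
  assumes "g (Suc M) = 0"
  shows "(\<Sum>i\<le>M. g (Suc i)) = (\<Sum>i\<le>M. g i) - g 0"
  using sum.atMost_Suc_shift[of g M] assms by (simp add: algebra_simps)

lemma sum_atMost_shift_down:
  fixes h :: "nat \<Rightarrow> 'a :: comm_monoid_add"
  assumes "h M = 0"
  shows "(\<Sum>i\<le>M. if 0 < i then h (i - 1) else 0) = (\<Sum>i\<le>M. h i)"
proof (cases M)
  case (Suc M')
  have "(\<Sum>i\<le>Suc M'. if 0 < i then h (i - 1) else 0) = (\<Sum>i\<le>M'. h i)"
    by (subst sum.atMost_Suc_shift) simp
  then show ?thesis using Suc assms by simp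
qed (use assms in simp)

text \<open>For \<open>n\<close> at most \<open>M\<close> this is the endpoint polynomial of the
  walks of length \<open>n\<close>. The bound \<open>M\<close> is independent of \<open>n\<close>,
  so that consecutive lengths share one summation range.\<close>

definition kreweras_sum :: "nat \<Rightarrow> nat \<Rightarrow> 'a::comm_ring_1 \<Rightarrow> 'a \<Rightarrow> 'a" where
  "kreweras_sum M n a b = (\<Sum>i\<le>M. \<Sum>j\<le>M. of_nat (kreweras n i j) * a ^ i * b ^ j)"

text \<open>The factor \<open>a * b\<close> clears the inverse powers in the step polynomial 1/a +
  1/b + ab. The subtracted terms are the steps that would leave the quadrant; the one for walks
  ending on the y-axis becomes \<open>b * r b\<close> by symmetry.\<close>

lemma kreweras_sum_Suc:
  fixes a b :: "'a::comm_ring_1"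
  assumes "n < M"
  defines "r \<equiv> \<lambda>c. \<Sum>i\<le>M. of_nat (kreweras n i 0) * c ^ i"
  shows "a * b * kreweras_sum M (Suc n) a b =
    (a + b + a\<^sup>2 * b\<^sup>2) * kreweras_sum M n a b - a * r a - b * r b"
proof -
  let ?k = "\<lambda>i j. of_nat (kreweras n i j) :: 'a"
  let ?Q = "kreweras_sum M n a b"
  have z: "?k i j = 0" if "M \<le> i \<or> M \<le> j" for i j
    using kreweras_eq_0[of n i j] that assms by auto
  have "a * b * kreweras_sum M (Suc n) a b =
      (\<Sum>i\<le>M. \<Sum>j\<le>M. if 0 < i \<and> 0 < j then a * b * ?k (i - 1) (j - 1) * a ^ i * b ^ j else 0)
      + (\<Sum>i\<le>M. \<Sum>j\<le>M. b * (?k (Suc i) j * a ^ Suc i * b ^ j))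
      + (\<Sum>i\<le>M. \<Sum>j\<le>M. a * (?k i (Suc j) * a ^ i * b ^ Suc j))"
    unfolding kreweras_sum_def sum_distrib_left sum.distrib[symmetric]
    by (intro sum.cong refl) (simp add: algebra_simps)
  \<comment> \<open>Writing \<open>i\<close> as \<open>Suc (i - 1)\<close> brings the summand into
    the form that \<open>sum_atMost_shift_down\<close> reindexes.\<close>
  also have "(\<Sum>i\<le>M. \<Sum>j\<le>M. if 0 < i \<and> 0 < j then a * b * ?k (i - 1) (j - 1) * a ^ i * b ^ j else 0)
      = (\<Sum>i\<le>M. if 0 < i then (\<Sum>j\<le>M. if 0 < j then a * b * ?k (i - 1) (j - 1) * a ^ Suc (i - 1) * b ^ Suc (j - 1) else 0) else 0)"
    by (intro sum.cong refl) (auto intro!: sum.cong)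
  also have "\<dots> = (\<Sum>i\<le>M. if 0 < i then (\<Sum>j\<le>M. a * b * ?k (i - 1) j * a ^ Suc (i - 1) * b ^ Suc j) else 0)"
    by (intro sum.cong refl if_cong sum_atMost_shift_down) (simp add: z)
  also have "\<dots> = (\<Sum>i\<le>M. \<Sum>j\<le>M. a * b * ?k i j * a ^ Suc i * b ^ Suc j)"
    by (rule sum_atMost_shift_down) (simp add: z)
  also have "\<dots> = a\<^sup>2 * b\<^sup>2 * ?Q"
    unfolding kreweras_sum_def sum_distrib_left
    by (intro sum.cong refl) (simp add: power2_eq_square algebra_simps)
  also have "(\<Sum>i\<le>M. \<Sum>j\<le>M. b * (?k (Suc i) j * a ^ Suc i * b ^ j)) = b * (?Q - r b)"
  proof -
    have "(\<Sum>i\<le>M. \<Sum>j\<le>M. b * (?k (Suc i) j * a ^ Suc i * b ^ j)) =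
        b * (\<Sum>i\<le>M. \<Sum>j\<le>M. ?k (Suc i) j * a ^ Suc i * b ^ j)"
      by (simp only: sum_distrib_left)
    also have "(\<Sum>i\<le>M. \<Sum>j\<le>M. ?k (Suc i) j * a ^ Suc i * b ^ j)
        = ?Q - (\<Sum>j\<le>M. ?k 0 j * a ^ 0 * b ^ j)"
      unfolding kreweras_sum_def by (rule sum_atMost_shift_up) (simp add: z)
    finally show ?thesis by (simp add: r_def kreweras_commute[of n 0])
  qed
  also have "(\<Sum>i\<le>M. \<Sum>j\<le>M. a * (?k i (Suc j) * a ^ i * b ^ Suc j)) = a * (?Q - r a)"
  proof -
    have "(\<Sum>i\<le>M. \<Sum>j\<le>M. a * (?k i (Suc j) * a ^ i * b ^ Suc j)) =
        a * (\<Sum>i\<le>M. \<Sum>j\<le>M. ?k i (Suc j) * a ^ i * b ^ Suc j)"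
      by (simp only: sum_distrib_left)
    also have "(\<Sum>i\<le>M. \<Sum>j\<le>M. ?k i (Suc j) * a ^ i * b ^ Suc j)
        = (\<Sum>i\<le>M. (\<Sum>j\<le>M. ?k i j * a ^ i * b ^ j) - ?k i 0 * a ^ i * b ^ 0)"
      by (intro sum.cong refl sum_atMost_shift_up) (simp add: z)
    finally show ?thesis by (simp add: r_def kreweras_sum_def sum_subtractf)
  qed
  finally show ?thesis by (simp add: algebra_simps)
qed

subsection \<open>Bivariate series and substitution\<close>

definition lift_eval :: "real fps \<Rightarrow> real poly \<Rightarrow> real fps" where
  "lift_eval y p = poly (map_poly fps_const p) y"

lemma lift_eval_0 [simp]: "lift_eval y 0 = 0"
  by (simp add: lift_eval_def)

lemma lift_eval_pCons [simp]: "lift_eval y (pCons c p) = fps_const c + y * lift_eval y p"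
  by (simp add: lift_eval_def map_poly_pCons)

lemma lift_eval_1 [simp]: "lift_eval y 1 = 1"
  by (simp add: one_pCons)

lemma lift_eval_add: "lift_eval y (p + q) = lift_eval y p + lift_eval y q"
  by (induction p q rule: poly_induct2) (auto simp: algebra_simps simp flip: fps_const_add)

lemma lift_eval_smult: "lift_eval y (smult c p) = fps_const c * lift_eval y p"
  by (induction p) (auto simp: algebra_simps simp flip: fps_const_mult)

lemma lift_eval_mult: "lift_eval y (p * q) = lift_eval y p * lift_eval y q"
  by (induction p) (auto simp: lift_eval_add lift_eval_smult algebra_simps)

lemma lift_eval_sum: "lift_eval y (sum f A) = (\<Sum>i\<in>A. lift_eval y (f i))"
  by (induction A rule: infinite_finite_induct) (auto simp: lift_eval_add)

lemma lift_eval_monom: "lift_eval y (monom c n) = fps_const c * y ^ n"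
  by (simp add: lift_eval_def map_poly_monom poly_monom)

lemma lift_eval_nth_0: "lift_eval y p $ 0 = poly p (y $ 0)"
  by (induction p) auto

text \<open>Bivariate series are elements of \<^typ>\<open>real poly fps\<close>: the series variable is $t$ and the
  polynomial variable is $x$. \<open>subst_x y P\<close> is $P(y(t), t)$; it makes sense for every $y$, even
  with nonzero constant term, since the coefficients of $P$ are polynomials.\<close>

definition subst_x :: "real fps \<Rightarrow> real poly fps \<Rightarrow> real fps" where
  "subst_x y P = Abs_fps (\<lambda>m. \<Sum>k\<le>m. lift_eval y (P $ k) $ (m - k))"

text \<open>Terms with \<open>k > m\<close> are divisible by t^(m+1), so any longer finite partial
  sum has the same coefficient. This reduces identities for \<open>subst_x\<close> to finite
  sums.\<close>

lemma subst_x_nth: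
  assumes "m \<le> M"
  shows "subst_x y P $ m = (\<Sum>k\<le>M. fps_X ^ k * lift_eval y (P $ k)) $ m"
proof -
  have "(\<Sum>k\<le>M. fps_X ^ k * lift_eval y (P $ k)) $ m =
      (\<Sum>k\<le>M. if k \<le> m then lift_eval y (P $ k) $ (m - k) else 0)"
    by (auto simp: fps_sum_nth fps_X_power_mult_nth intro!: sum.cong)
  also have "\<dots> = (\<Sum>k\<in>{..M} \<inter> {..m}. lift_eval y (P $ k) $ (m - k))"
    by (subst sum.inter_restrict) (auto intro!: sum.cong)
  also have "{..M} \<inter> {..m} = {..m}" using assms by auto
  finally show ?thesis by (simp add: subst_x_def)
qed

lemma subst_x_add: "subst_x y (P + Q) = subst_x y P + subst_x y Q"
  by (auto simp: subst_x_def fps_eq_iff lift_eval_add sum.distrib)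

lemma subst_x_0 [simp]: "subst_x y 0 = 0"
  by (auto simp: subst_x_def fps_eq_iff)

lemma subst_x_diff: "subst_x y (P - Q) = subst_x y P - subst_x y Q"
  using subst_x_add[of y "P - Q" Q] by simp

lemma subst_x_const: "subst_x y (fps_const p) = lift_eval y p"
proof (rule fps_ext)
  fix m
  have "subst_x y (fps_const p) $ m = (\<Sum>k\<in>{0}. lift_eval y (fps_const p $ k) $ (m - k))"
    unfolding subst_x_def fps_nth_Abs_fps by (rule sum.mono_neutral_right) auto
  then show "subst_x y (fps_const p) $ m = lift_eval y p $ m" by simp
qed

lemma subst_x_1 [simp]: "subst_x y 1 = 1"
  using subst_x_const[of y 1] by simp

lemma subst_x_2 [simp]: "subst_x y 2 = 2"
  using subst_x_add[of y 1 1] by simp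

lemma subst_x_fps_X [simp]: "subst_x y fps_X = fps_X"
proof (rule fps_ext)
  fix m
  have "subst_x y fps_X $ m = (\<Sum>k\<le>Suc m. fps_X ^ k * lift_eval y (fps_X $ k)) $ m"
    by (rule subst_x_nth) simp
  also have "(\<Sum>k\<le>Suc m. fps_X ^ k * lift_eval y (fps_X $ k)) =
      (\<Sum>k\<in>{1}. fps_X ^ k * lift_eval y (fps_X $ k))"
    by (rule sum.mono_neutral_right) (auto simp: fps_X_def)
  finally show "subst_x y fps_X $ m = fps_X $ m" by simp
qed

text \<open>Multiply the partial sums up to \<open>m\<close>. Products with \<open>i + j > m\<close>
  do not reach t^m, and grouping the rest by \<open>k = i + j\<close> yields the Cauchy
  product.\<close>

lemma subst_x_mult: "subst_x y (P * Q) = subst_x y P * subst_x y Q"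
proof (rule fps_ext)
  fix m
  let ?p = "\<lambda>k. fps_X ^ k * lift_eval y (P $ k)" and ?q = "\<lambda>k. fps_X ^ k * lift_eval y (Q $ k)"
  have "(subst_x y P * subst_x y Q) $ m = ((\<Sum>k\<le>m. ?p k) * (\<Sum>k\<le>m. ?q k)) $ m"
    unfolding fps_mult_nth by (intro sum.cong refl arg_cong2[where f = "(*)"] subst_x_nth) auto
  also have "\<dots> = (\<Sum>(i, j)\<in>{..m} \<times> {..m}. (?p i * ?q j) $ m)"
    by (simp add: sum_product sum.cartesian_product fps_sum_nth case_prod_unfold)
  also have "\<dots> = (\<Sum>(i, j)\<in>{(i, j). i + j \<le> m}. (?p i * ?q j) $ m)"
  proof (rule sum.mono_neutral_right)
    have "?p i * ?q j = fps_X ^ (i + j) * (lift_eval y (P $ i) * lift_eval y (Q $ j))" for i j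
      by (simp add: power_add algebra_simps)
    then have zero: "(?p i * ?q j) $ m = 0" if "m < i + j" for i j
      using that by (simp only: fps_X_power_mult_nth) simp
    show "\<forall>z\<in>{..m} \<times> {..m} - {(i, j). i + j \<le> m}. (case z of (i, j) \<Rightarrow> (?p i * ?q j) $ m) = 0"
    proof
      fix z assume z: "z \<in> {..m} \<times> {..m} - {(i, j). i + j \<le> m}"
      obtain i j where "z = (i, j)" by (cases z)
      with z zero[of i j] show "(case z of (i, j) \<Rightarrow> (?p i * ?q j) $ m) = 0" by simp
    qed
  qed auto
  also have "\<dots> = (\<Sum>k\<le>m. \<Sum>i\<le>k. (?p i * ?q (k - i)) $ m)"
    by (rule sum.triangle_reindex_eq)
  also have "\<dots> = (\<Sum>k\<le>m. fps_X ^ k * lift_eval y ((P * Q) $ k)) $ m"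
    unfolding fps_sum_nth
  proof (rule sum.cong[OF refl])
    fix k assume "k \<in> {..m}"
    have "fps_X ^ k * lift_eval y ((P * Q) $ k) =
        (\<Sum>i\<le>k. fps_X ^ k * (lift_eval y (P $ i) * lift_eval y (Q $ (k - i))))"
      by (simp add: fps_mult_nth lift_eval_sum lift_eval_mult sum_distrib_left atMost_atLeast0)
    also have "\<dots> = (\<Sum>i\<le>k. ?p i * ?q (k - i))"
    proof (rule sum.cong[OF refl])
      fix i assume "i \<in> {..k}"
      then have "(fps_X :: real fps) ^ k = fps_X ^ i * fps_X ^ (k - i)"
        by (simp flip: power_add)
      then show "fps_X ^ k * (lift_eval y (P $ i) * lift_eval y (Q $ (k - i))) = ?p i * ?q (k - i)"
        by (simp add: algebra_simps)
    qed
    finally show "(\<Sum>i\<le>k. (?p i * ?q (k - i)) $ m) = (fps_X ^ k * lift_eval y ((P * Q) $ k)) $ m"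
      by (simp add: fps_sum_nth)
  qed
  also have "\<dots> = subst_x y (P * Q) $ m"
    by (rule subst_x_nth[symmetric]) simp
  finally show "subst_x y (P * Q) $ m = (subst_x y P * subst_x y Q) $ m" by simp
qed

lemma subst_x_power: "subst_x y (P ^ n) = subst_x y P ^ n"
  by (induction n) (auto simp: subst_x_mult)

lemmas subst_x_simps = subst_x_add subst_x_diff subst_x_mult subst_x_power

section \<open>Formal differentiation in x\<close>

definition deriv_x :: "real poly fps \<Rightarrow> real poly fps" where
  "deriv_x P = Abs_fps (\<lambda>n. pderiv (P $ n))"

lemma deriv_x_add: "deriv_x (P + Q) = deriv_x P + deriv_x Q"
  by (simp add: deriv_x_def fps_eq_iff pderiv_add)

lemma deriv_x_diff: "deriv_x (P - Q) = deriv_x P - deriv_x Q"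
  by (simp add: deriv_x_def fps_eq_iff pderiv_diff)

lemma deriv_x_mult: "deriv_x (P * Q) = P * deriv_x Q + deriv_x P * Q"
proof -
  have *: "pderiv (sum f A) = (\<Sum>i\<in>A. pderiv (f i))" for f :: "nat \<Rightarrow> real poly" and A
    by (induction A rule: infinite_finite_induct) (auto simp: pderiv_add)
  show ?thesis
    by (simp add: deriv_x_def fps_eq_iff fps_mult_nth * pderiv_mult sum.distrib
        mult.commute[of "Q $ _"])
qed

lemma deriv_x_fps_X: "deriv_x fps_X = 0"
  by (simp add: deriv_x_def fps_eq_iff fps_X_def)

lemma deriv_x_const: "deriv_x (fps_const p) = fps_const (pderiv p)"
  by (simp add: deriv_x_def fps_eq_iff fps_const_def)

section \<open>Agreement modulo t^n and fixed points\<close>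

definition fps_agree :: "nat \<Rightarrow> real fps \<Rightarrow> real fps \<Rightarrow> bool" where
  "fps_agree n a b \<longleftrightarrow> (\<forall>k<n. a $ k = b $ k)"

lemma fps_agree_refl [simp]: "fps_agree n a a"
  by (simp add: fps_agree_def)

lemma fps_agree_add: "fps_agree n a b \<Longrightarrow> fps_agree n c d \<Longrightarrow> fps_agree n (a + c) (b + d)"
  by (simp add: fps_agree_def)

lemma fps_agree_mult: "fps_agree n a b \<Longrightarrow> fps_agree n c d \<Longrightarrow> fps_agree n (a * c) (b * d)"
  by (auto simp: fps_agree_def fps_mult_nth intro!: sum.cong)

lemma fps_agree_power: "fps_agree n a b \<Longrightarrow> fps_agree n (a ^ k) (b ^ k)"
  by (induction k) (auto intro: fps_agree_mult)

text \<open>The source of contraction: a factor t gains one order of agreement.\<close>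

lemma fps_agree_X_mult: "fps_agree n a b \<Longrightarrow> fps_agree (Suc n) (fps_X * a) (fps_X * b)"
  by (auto simp: fps_agree_def)

text \<open>Allows an unknown series to occur inside \<open>subst_x\<close> in a fixed-point
  equation.\<close>

lemma fps_agree_subst_x:
  assumes "fps_agree n a b"
  shows "fps_agree n (subst_x a P) (subst_x b P)"
proof -
  have "fps_agree n (lift_eval a p) (lift_eval b p)" for p
    using assms by (induction p) (auto intro: fps_agree_add fps_agree_mult)
  then show ?thesis
    by (auto simp: fps_agree_def subst_x_def intro!: sum.cong)
qed

text \<open>The Banach iteration in the t-adic metric, started at 0: coefficient \<open>k\<close> no
  longer changes from iterate \<open>Suc k\<close> on, and the limit \<open>L\<close> collects these
  settled values.\<close>

lemma fps_fixpoint_exists: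
  assumes contr: "\<And>n a b. fps_agree n a b \<Longrightarrow> fps_agree (Suc n) (\<Phi> a) (\<Phi> b)"
  shows "\<exists>a. \<Phi> a = a"
proof -
  define s where "s n = (\<Phi> ^^ n) 0" for n
  have s_Suc: "s (Suc n) = \<Phi> (s n)" for n by (simp add: s_def)
  have step: "fps_agree n (s n) (s (n + d))" for n d
  proof (induction n)
    case (Suc n)
    then show ?case using contr[OF Suc] by (simp add: s_Suc)
  qed (simp add: fps_agree_def)
  define L where "L = Abs_fps (\<lambda>k. s (Suc k) $ k)"
  have L: "fps_agree n L (s n)" for n
    unfolding fps_agree_def
  proof (intro allI impI)
    fix k assume "k < n"
    then have "fps_agree (Suc k) (s (Suc k)) (s n)"
      using step[of "Suc k" "n - Suc k"] by simp
    then show "L $ k = s n $ k" by (simp add: L_def fps_agree_def)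
  qed
  have "\<Phi> L $ k = L $ k" for k
    using contr[OF L[of k]] by (auto simp: fps_agree_def L_def s_Suc)
  then show ?thesis by (auto simp: fps_eq_iff)
qed

subsection \<open>The kernel and its invariant\<close>

definition kreweras_R :: "real poly fps" where
  "kreweras_R = Abs_fps (\<lambda>n. \<Sum>i\<le>n. monom (real (kreweras n i 0)) i)"

lemma lift_eval_kreweras_R:
  assumes "n \<le> M"
  shows "lift_eval y (kreweras_R $ n) = (\<Sum>i\<le>M. of_nat (kreweras n i 0) * y ^ i)"
proof -
  have "lift_eval y (kreweras_R $ n) = (\<Sum>i\<le>n. of_nat (kreweras n i 0) * y ^ i)"
    by (simp add: kreweras_R_def lift_eval_sum lift_eval_monom fps_of_nat)
  also have "\<dots> = (\<Sum>i\<le>M. of_nat (kreweras n i 0) * y ^ i)"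
    using assms by (intro sum.mono_neutral_left) (auto simp: kreweras_eq_0)
  finally show ?thesis .
qed

text \<open>The kernel method: on the curve \<open>K\<close> the step recurrence, weighted by t^N,
  telescopes. Working with finite lengths avoids substituting two series into the full generating
  function.\<close>

lemma kreweras_kernel:
  fixes a b :: "real fps"
  assumes K: "a * b = fps_X * (a + b + a\<^sup>2 * b\<^sup>2)"
  shows "a * b = fps_X * a * subst_x a kreweras_R + fps_X * b * subst_x b kreweras_R"
proof (rule fps_ext)
  fix m
  let ?r = "\<lambda>y n. lift_eval y (kreweras_R $ n)"
  let ?s = "\<lambda>y N. \<Sum>n<N. fps_X ^ n * ?r y n"
  let ?M = "Suc m"
  \<comment> \<open>The remainder on the left is divisible by t^N, so at \<open>N = Suc m\<close> it
    vanishes in the coefficient of t^m.\<close>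
  have tele: "fps_X ^ N * (a * b * kreweras_sum ?M N a b) =
      a * b - fps_X * a * ?s a N - fps_X * b * ?s b N" if "N \<le> ?M" for N
    using that
  proof (induction N)
    case 0
    have "kreweras_sum ?M 0 a b = (\<Sum>i\<le>?M. \<Sum>j\<le>?M. if j = 0 then if i = 0 then 1 else 0 else 0)"
      unfolding kreweras_sum_def by (intro sum.cong refl) simp
    also have "\<dots> = 1"
      by (simp only: sum.delta finite_atMost atMost_iff zero_le if_True)
    finally have "kreweras_sum ?M 0 a b = 1" .
    then show ?case by simp
  next
    case (Suc N)
    then have N: "N < ?M" by simp
    have "fps_X ^ Suc N * (a * b * kreweras_sum ?M (Suc N) a b) =
        fps_X ^ N * ((fps_X * (a + b + a\<^sup>2 * b\<^sup>2)) * kreweras_sum ?M N a b)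
        - fps_X ^ Suc N * (a * ?r a N + b * ?r b N)"
    proof -
      have rec: "a * b * kreweras_sum ?M (Suc N) a b =
          (a + b + a\<^sup>2 * b\<^sup>2) * kreweras_sum ?M N a b - a * ?r a N - b * ?r b N"
        using kreweras_sum_Suc[OF N, of a b] N by (simp only: lift_eval_kreweras_R[OF less_imp_le])
      show ?thesis unfolding rec by (simp add: algebra_simps)
    qed
    also have "\<dots> = a * b - fps_X * a * ?s a N - fps_X * b * ?s b N
        - fps_X ^ Suc N * (a * ?r a N + b * ?r b N)"
      unfolding K[symmetric] using Suc by simp
    finally show ?case by (simp add: algebra_simps)
  qed
  have s: "(fps_X * c * ?s c ?M) $ m = (fps_X * c * subst_x c kreweras_R) $ m" for c
    unfolding fps_mult_nth[of "fps_X * c"] lessThan_Suc_atMost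
    by (intro sum.cong refl arg_cong2[where f = "(*)"] subst_x_nth[symmetric]) auto
  have "0 = (fps_X ^ ?M * (a * b * kreweras_sum ?M ?M a b)) $ m"
    by (simp only: fps_X_power_mult_nth) simp
  also have "\<dots> = (a * b) $ m - (fps_X * a * ?s a ?M) $ m - (fps_X * b * ?s b ?M) $ m"
    by (subst tele) simp_all
  finally show "(a * b) $ m = (fps_X * a * subst_x a kreweras_R + fps_X * b * subst_x b kreweras_R) $ m"
    unfolding s by simp
qed

text \<open>Dividing the kernel equation by c gives y = t(1 + y/c + c y^2), a contraction. Its
  solution is nonzero since 0 is mapped to t.\<close>

lemma kernel_root_exists:
  fixes c :: real
  assumes "c \<noteq> 0"
  obtains y where "fps_const c * y = fps_X * (fps_const c + y + (fps_const c)\<^sup>2 * y\<^sup>2)"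
    "y $ 0 = 0" "y \<noteq> 0"
proof -
  define \<Phi> where "\<Phi> = (\<lambda>y. fps_X * (1 + fps_const (inverse c) * y + fps_const c * y\<^sup>2))"
  have "\<exists>y. \<Phi> y = y"
    unfolding \<Phi>_def
    by (intro fps_fixpoint_exists fps_agree_X_mult fps_agree_add fps_agree_mult fps_agree_power)
       auto
  then obtain y where y: "\<Phi> y = y" by blast
  have "y $ 0 = 0" by (subst y[symmetric]) (simp add: \<Phi>_def)
  moreover have "y \<noteq> 0" using y by (auto simp: \<Phi>_def)
  moreover have "fps_const c * y = fps_X * (fps_const c + y + (fps_const c)\<^sup>2 * y\<^sup>2)"
  proof -
    have "fps_const c * fps_const (inverse c) = 1"
      using assms by simp
    then show ?thesis
      using y unfolding \<Phi>_def by algebra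
  qed
  ultimately show thesis using that by blast
qed

definition var_x :: "real poly fps" where
  "var_x = fps_const [:0, 1:]"

lemma subst_x_var_x [simp]: "subst_x y var_x = y"
  by (simp add: var_x_def subst_x_const)

lemma deriv_x_var_x: "deriv_x var_x = 1"
  by (simp add: var_x_def deriv_x_const pderiv_pCons flip: one_pCons)

text \<open>With T(x) = txR(x) + 1/x - 1/(2t), the two kernel equations say T(a) = -T(b), so T^2 is
  invariant. So is x + 1/(tx) - 1/x^2, by the kernel alone. Their sum minus 1/(4t^2) is this series,
  free of poles in x.\<close>

definition kreweras_I :: "real poly fps" where
  "kreweras_I = fps_X\<^sup>2 * var_x\<^sup>2 * kreweras_R\<^sup>2 - var_x * kreweras_R + 2 * fps_X * kreweras_R + var_x"

lemma subst_x_kreweras_I: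
  "subst_x y kreweras_I = fps_X\<^sup>2 * y\<^sup>2 * (subst_x y kreweras_R)\<^sup>2 - y * subst_x y kreweras_R
     + 2 * fps_X * subst_x y kreweras_R + y"
  by (simp add: kreweras_I_def subst_x_simps)

lemma kreweras_I_invariant:
  fixes a b :: "real fps"
  assumes K: "a * b = fps_X * (a + b + a\<^sup>2 * b\<^sup>2)" and "a \<noteq> 0" "b \<noteq> 0"
  shows "subst_x a kreweras_I = subst_x b kreweras_I"
proof -
  define r where "r = subst_x a kreweras_R"
  define s where "s = subst_x b kreweras_R"
  have E: "a * b = fps_X * a * r + fps_X * b * s"
    unfolding r_def s_def by (rule kreweras_kernel[OF K])
  have "a * b * (subst_x a kreweras_I - subst_x b kreweras_I) = 0"
    using K E unfolding subst_x_kreweras_I r_def[symmetric] s_def[symmetric] by algebra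
  then have "subst_x a kreweras_I - subst_x b kreweras_I = 0"
    using assms(2,3) by (metis mult_eq_0_iff)
  then show ?thesis by simp
qed

text \<open>The invariant lemma: as $y(t) = O(t)$, comparing the coefficients of $t^m$ in
  $P(c) = P(y)$ gives $P_m(c) = P_m(0)$ once the lower coefficients are known to be constant.\<close>

lemma invariant_imp_constant:
  fixes P :: "real poly fps"
  assumes "\<And>c. c \<noteq> 0 \<Longrightarrow> \<exists>y. y $ 0 = 0 \<and> subst_x (fps_const c) P = subst_x y P"
  shows "P $ m = [:poly (P $ m) 0:]"
proof (induction m rule: less_induct)
  case (less m)
  have "poly (P $ m) c = poly (P $ m) 0" for c
  proof (cases "c = 0")
    case False
    then obtain y where y: "y $ 0 = 0" "subst_x (fps_const c) P = subst_x y P"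
      using assms by blast
    \<comment> \<open>A lower coefficient \<open>P $ k\<close> is constant by induction, so its
      evaluation has no coefficient at the positive index \<open>m - k\<close>.\<close>
    have split: "subst_x z P $ m = lift_eval z (P $ m) $ 0" for z
    proof -
      have "subst_x z P $ m = (\<Sum>k\<in>{m}. lift_eval z (P $ k) $ (m - k))"
        unfolding subst_x_def fps_nth_Abs_fps
      proof (rule sum.mono_neutral_right)
        show "\<forall>k\<in>{..m} - {m}. lift_eval z (P $ k) $ (m - k) = 0"
        proof
          fix k assume k: "k \<in> {..m} - {m}"
          then have "lift_eval z (P $ k) = fps_const (poly (P $ k) 0)"
            by (subst less.IH) auto
          with k show "lift_eval z (P $ k) $ (m - k) = 0" by auto
        qed
      qed auto
      then show ?thesis by simp
    qed
    show ?thesis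
      using split[of "fps_const c"] split[of y] y by (simp add: lift_eval_nth_0)
  qed simp
  then show ?case by (intro poly_ext) simp
qed

lemma kreweras_I_nth: "kreweras_I $ m = [:poly (kreweras_I $ m) 0:]"
proof (rule invariant_imp_constant)
  fix c :: real assume c: "c \<noteq> 0"
  then obtain y where "fps_const c * y = fps_X * (fps_const c + y + (fps_const c)\<^sup>2 * y\<^sup>2)"
    "y $ 0 = 0" "y \<noteq> 0" by (rule kernel_root_exists)
  with c show "\<exists>y. y $ 0 = 0 \<and> subst_x (fps_const c) kreweras_I = subst_x y kreweras_I"
    using kreweras_I_invariant[of "fps_const c" y] by auto
qed

text \<open>As the invariant does not depend on x, its value at any \<open>y\<close> is its value at
  0, where only the term 2tR(0) survives.\<close>

lemma subst_x_kreweras_I_eq: "subst_x y kreweras_I = 2 * fps_X * subst_x 0 kreweras_R"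
proof -
  have "lift_eval z (kreweras_I $ m) = fps_const (poly (kreweras_I $ m) 0)" for z m
    by (subst kreweras_I_nth) simp
  then have "subst_x y kreweras_I = subst_x 0 kreweras_I"
    by (simp add: subst_x_def)
  then show ?thesis by (simp add: subst_x_kreweras_I)
qed

lemma deriv_x_kreweras_I: "deriv_x kreweras_I = 0"
proof (rule fps_ext)
  fix m
  have "pderiv (kreweras_I $ m) = 0"
    by (subst kreweras_I_nth) (simp add: pderiv_pCons)
  then show "deriv_x kreweras_I $ m = 0 $ m" by (simp add: deriv_x_def)
qed

text \<open>The quadratic method: in the x-derivative of the invariant, R' has the coefficient 2t^2
  x^2 R - x + 2t. Its root \<open>W\<close> leaves two equations in \<open>W\<close> and R(W), and
  the invariant itself then gives R(0).\<close>

lemma kreweras_series_algebraic: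
  obtains W :: "real fps" where "W = fps_X * (2 + W ^ 3)"
    "8 * fps_X * subst_x 0 kreweras_R = 4 * W - W ^ 4"
proof -
  let ?R = "kreweras_R" and ?t = "fps_X :: real fps"
  have "\<exists>W. fps_X * (2 + 2 * fps_X * W\<^sup>2 * subst_x W ?R) = W"
    by (intro fps_fixpoint_exists fps_agree_X_mult fps_agree_add fps_agree_mult fps_agree_power
        fps_agree_subst_x) auto
  then obtain W where W: "W = ?t * (2 + 2 * ?t * W\<^sup>2 * subst_x W ?R)" by metis
  define r where "r = subst_x W ?R"
  define r' where "r' = subst_x W (deriv_x ?R)"
  have 2: "deriv_x 2 = 0"
    using deriv_x_const[of "[:2:]"] by (simp add: numeral_fps_const numeral_poly pderiv_pCons)
  have "deriv_x kreweras_I = fps_X\<^sup>2 * (2 * var_x * ?R\<^sup>2 + var_x\<^sup>2 * (2 * ?R * deriv_x ?R))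
      - ?R - var_x * deriv_x ?R + 2 * fps_X * deriv_x ?R + 1"
    unfolding kreweras_I_def power2_eq_square
    by (simp add: deriv_x_add deriv_x_diff deriv_x_mult deriv_x_fps_X deriv_x_var_x 2 algebra_simps)
  then have "subst_x W (fps_X\<^sup>2 * (2 * var_x * ?R\<^sup>2 + var_x\<^sup>2 * (2 * ?R * deriv_x ?R))
      - ?R - var_x * deriv_x ?R + 2 * fps_X * deriv_x ?R + 1) = 0"
    by (simp add: deriv_x_kreweras_I)
  then have D: "?t\<^sup>2 * (2 * W * r\<^sup>2 + W\<^sup>2 * (2 * r * r')) - r - W * r' + 2 * ?t * r' + 1 = 0"
    by (simp add: subst_x_simps r_def r'_def)
  have W': "W = ?t * (2 + 2 * ?t * W\<^sup>2 * r)" using W by (simp add: r_def)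
  have D': "2 * ?t\<^sup>2 * W * r\<^sup>2 - r + 1 = 0"
    using D W' by algebra
  \<comment> \<open>Multiply \<open>W'\<close> by \<open>r\<close> and replace 2t^2 W r^2 by r - 1
    using \<open>D'\<close>; the terms W r cancel.\<close>
  have rW: "2 * ?t * r = W"
    using D' W' by algebra
  have W3: "W = ?t * (2 + W ^ 3)"
    using W' rW by algebra
  have "?t\<^sup>2 * W\<^sup>2 * r\<^sup>2 - W * r + 2 * ?t * r + W = 2 * ?t * subst_x 0 ?R"
    using subst_x_kreweras_I_eq[of W] by (simp add: subst_x_kreweras_I r_def)
  \<comment> \<open>The extra factor t is there because \<open>r\<close> is known only through
    \<open>rW\<close>, which turns t W r into W^2/2.\<close>
  then have "?t * (8 * ?t * subst_x 0 ?R - (4 * W - W ^ 4)) = 0"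
    using rW W3 by algebra
  then have "8 * ?t * subst_x 0 ?R = 4 * W - W ^ 4" by simp
  with W3 show thesis by (rule that)
qed

lemma subst_x_0_kreweras_R_nth: "subst_x 0 kreweras_R $ n = real (kreweras n 0 0)"
proof -
  have "lift_eval 0 (kreweras_R $ k) = fps_const (real (kreweras k 0 0))" for k
  proof -
    have "lift_eval 0 (kreweras_R $ k) = (\<Sum>i\<le>k. if i = 0 then of_nat (kreweras k 0 0) else 0)"
      unfolding lift_eval_kreweras_R[OF order_refl] by (intro sum.cong refl) simp
    then show ?thesis by (simp add: fps_of_nat)
  qed
  then have "subst_x 0 kreweras_R $ n = (\<Sum>k\<le>n. if k = n then real (kreweras n 0 0) else 0)"
    unfolding subst_x_def fps_nth_Abs_fps by (intro sum.cong) auto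
  then show ?thesis by simp
qed

subsection \<open>The coefficients\<close>

text \<open>The operator \<open>fps_XD\<close> is t d/dt. Implicit differentiation expresses its
  action on \<open>W\<close> rationally in \<open>W\<close>, so the equation becomes a polynomial
  identity in \<open>W\<close>. The term 18t balances the lowest coefficient, as H = 2t +
  O(t^4).\<close>

lemma kreweras_ode:
  fixes W H :: "real fps"
  assumes W: "W = fps_X * (2 + W ^ 3)" and H: "4 * H = 4 * W - W ^ 4"
  shows "2 * fps_XD (fps_XD H) + 5 * fps_XD H + 2 * H - 18 * fps_X =
    54 * fps_X ^ 3 * (fps_XD (fps_XD H) + fps_XD H)"
proof -
  let ?t = "fps_X :: real fps"
  define V where "V = fps_XD W"
  have num: "fps_deriv (numeral k * f) = numeral k * fps_deriv f" for k and f :: "real fps"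
    by (simp add: numeral_fps_const)
  have V: "V = ?t * (2 + W ^ 3) + 3 * ?t * W\<^sup>2 * V"
  proof -
    have "V = ?t * fps_deriv (?t * (2 + W ^ 3))"
      unfolding V_def fps_XD_def using W by simp
    also have "fps_deriv (?t * (2 + W ^ 3)) = 2 + W ^ 3 + ?t * (3 * fps_deriv W * W\<^sup>2)"
      by (simp add: fps_deriv_power')
    finally have "V = ?t * (2 + W ^ 3 + ?t * (3 * fps_deriv W * W\<^sup>2))" .
    moreover have "V = ?t * fps_deriv W" by (simp add: V_def fps_XD_def)
    ultimately show ?thesis by algebra
  qed
  have "4 * fps_XD H = fps_XD (4 * H)" by (simp add: fps_XD_def num)
  also have "\<dots> = 4 * V - 4 * W ^ 3 * V"
    unfolding H by (simp add: V_def fps_XD_def num fps_deriv_power' algebra_simps)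
  finally have "4 * fps_XD H = 4 * (V - W ^ 3 * V)" by (simp add: algebra_simps)
  then have H1: "fps_XD H = V - W ^ 3 * V" by (subst (asm) mult_left_cancel) simp_all
  \<comment> \<open>Multiplying \<open>V\<close> by 2 + W^3 eliminates t through t(2 + W^3) =
    W.\<close>
  have VW: "2 * (1 - W ^ 3) * V = W * (2 + W ^ 3)"
    using V W by algebra
  then have H1': "2 * fps_XD H = 2 * W + W ^ 4" using H1 by algebra
  have "2 * fps_XD (fps_XD H) = fps_XD (2 * fps_XD H)" by (simp add: fps_XD_def num)
  also have "\<dots> = 2 * (V + 2 * W ^ 3 * V)"
    unfolding H1' by (simp add: V_def fps_XD_def num fps_deriv_power' algebra_simps)
  finally have H2: "fps_XD (fps_XD H) = V + 2 * W ^ 3 * V"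
    by (subst (asm) mult_left_cancel) simp_all
  let ?E = "2 * fps_XD (fps_XD H) + 5 * fps_XD H + 2 * H - 18 * ?t -
    54 * ?t ^ 3 * (fps_XD (fps_XD H) + fps_XD H)"
  have W0: "W $ 0 = 0" by (subst W) simp
  \<comment> \<open>The factor 1 - W^3 removes \<open>V\<close> by \<open>VW\<close>. The sum of the
    derivatives on the right is V(2 + W^3), so one more factor 2 + W^3 suffices to absorb t^3. Both
    factors have nonzero constant term and cancel.\<close>
  have "(1 - W ^ 3) * (2 + W ^ 3) * (4 * ?E) = 0"
    using H H1' H2 VW W by algebra
  moreover have "(1 - W ^ 3) $ 0 \<noteq> 0" "(2 + W ^ 3) $ 0 \<noteq> 0"
    using W0 by (simp_all add: fps_power_zeroth fps_numeral_nth)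
  then have "1 - W ^ 3 \<noteq> 0" "2 + W ^ 3 \<noteq> 0" by (metis fps_zero_nth)+
  ultimately have "?E = 0" by (simp only: mult_eq_0_iff) simp
  then show ?thesis by algebra
qed

lemma kreweras_recurrence:
  "real ((m + 6) * (2 * m + 9)) * real (kreweras (m + 3) 0 0) =
     54 * real ((m + 1) * (m + 2)) * real (kreweras m 0 0)"
proof -
  obtain W :: "real fps" where W: "W = fps_X * (2 + W ^ 3)"
    and R: "8 * fps_X * subst_x 0 kreweras_R = 4 * W - W ^ 4"
    by (rule kreweras_series_algebraic)
  define H where "H = 2 * fps_X * subst_x 0 kreweras_R"
  have "4 * H = 4 * W - W ^ 4" using R by (simp add: H_def mult.assoc)
  note ode = kreweras_ode[OF W this]
  have H: "H $ Suc n = 2 * real (kreweras n 0 0)" for n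
    by (simp add: H_def numeral_fps_const mult.assoc subst_x_0_kreweras_R_nth)
  have c: "(numeral k * f) $ n = numeral k * f $ n" for k n and f :: "real fps"
    by (simp add: numeral_fps_const)
  have XD: "fps_XD f $ n = of_nat n * f $ n" for n and f :: "real fps"
    by (simp add: fps_XD_def)
  \<comment> \<open>The index m + 4 lies beyond the term 18t, and \<open>H\<close> is shifted by one
    against the walk counts. The left factor 2N^2 + 5N + 2 at N = m + 4 is (m + 6)(2m + 9).\<close>
  have "(2 * fps_XD (fps_XD H) + 5 * fps_XD H + 2 * H - 18 * fps_X) $ (m + 4) =
    (54 * (fps_X ^ 3 * (fps_XD (fps_XD H) + fps_XD H))) $ (m + 4)"
    using ode by (simp add: mult.assoc)
  then have "(2 * real (m + 4) ^ 2 + 5 * real (m + 4) + 2) * H $ Suc (m + 3) =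
      54 * (real (m + 1) ^ 2 + real (m + 1)) * H $ Suc m"
    by (simp only: fps_add_nth fps_sub_nth c XD fps_X_power_mult_nth)
       (simp add: power2_eq_square algebra_simps)
  then show ?thesis unfolding H by (simp add: algebra_simps power2_eq_square)
qed

lemma kreweras_closed_form:
  "real (kreweras (3 * n) 0 0) = 4 ^ n * fact (3 * n) / (fact (n + 1) * fact (2 * n + 1))"
proof (induction n)
  case (Suc n)
  have rec: "real (n + 2) * real (2 * n + 3) * real (kreweras (3 * Suc n) 0 0) =
      6 * real (3 * n + 1) * real (3 * n + 2) * real (kreweras (3 * n) 0 0)"
    using kreweras_recurrence[of "3 * n"] by (simp add: algebra_simps)
  have "real (kreweras (3 * Suc n) 0 0) = 6 * real (3 * n + 1) * real (3 * n + 2) *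
      real (kreweras (3 * n) 0 0) / (real (n + 2) * real (2 * n + 3))"
    using rec by (simp add: nonzero_eq_divide_eq mult.commute del: kreweras.simps)
  also have "\<dots> = 6 * real (3 * n + 1) * real (3 * n + 2) *
      (4 ^ n * fact (3 * n) / (fact (n + 1) * fact (2 * n + 1))) / (real (n + 2) * real (2 * n + 3))"
    by (simp only: Suc.IH)
  also have "\<dots> = 4 ^ Suc n * (real (3 * n + 3) * real (3 * n + 2) * real (3 * n + 1) * fact (3 * n)) /
      ((real (n + 2) * fact (n + 1)) * (real (2 * n + 3) * real (2 * n + 2) * fact (2 * n + 1)))"
  proof -
    \<comment> \<open>The fraction is extended by w = n + 1, with 6 = 4 * 3/2, to supply the factors
      3n + 3 and 2n + 2 missing from the factorials.\<close>
    have "6 * a * b * (p * f / (g * h)) / (u * v) =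
        4 * p * (3 * w * b * a * f) / ((u * g) * (v * (2 * w) * h))"
      if "w \<noteq> 0" for a b p f g h u v w :: real
      using that by (simp add: divide_simps)
    note this[of "real (n + 1)"]
    moreover have "real (3 * n + 3) = 3 * real (n + 1)" "real (2 * n + 2) = 2 * real (n + 1)"
      by simp_all
    ultimately show ?thesis by (simp only: power_Suc)
  qed
  also have "real (3 * n + 3) * real (3 * n + 2) * real (3 * n + 1) * fact (3 * n) = fact (3 * Suc n)"
    by (simp add: numeral_3_eq_3 algebra_simps)
  also have "real (n + 2) * fact (n + 1) = fact (Suc n + 1)"
    by simp
  also have "real (2 * n + 3) * real (2 * n + 2) * fact (2 * n + 1) = fact (2 * Suc n + 1)"
    by (simp add: algebra_simps)
  finally show ?case .
qed simp

theorem theorem3: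
  fixes n :: nat
  assumes "n \<ge> 1"
  shows "real (ILF2 n) = 4 ^ n * fact (3 * n) / (fact (n + 1) * fact (2 * n + 1))"
  unfolding ILF2_eq_kreweras by (rule kreweras_closed_form)

end
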